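(* Let $n\ge1$ and $N\ge1$ be integers, let $\nu_1,\dots,\nu_N\in\mathbb R$, and let $\beta_n\in(0,\pi)$ be the minimum point of $SI_n$ on $(0,\pi)$. Suppose that $\alpha_n$, $\kappa$ and the initial data $\Theta^0=(\theta_1^0,\dots,\theta_N^0)$ satisfy $$\beta_n<\alpha_n<\pi,\qquad \Theta^0\in B(\alpha_n),\qquad \kappa>\frac{\max_{1\le i\le N}|\nu_i|}{|(SI_n)(\alpha_n)|}.$$ Let $\Theta(t)$, $t\ge 0$, be the global solution of the Winfree model of order $n$ with $\Theta(0)=\Theta^0$. Then there exists a constant $t_*\ge0$ such that $$\Theta(t)\in B(\alpha_n^* )\qquad\text{for all } t\ge t_*,$$ where $\alpha_n^*\in(0,\pi)$ is the unique point with $\alpha_n^*\le\beta_n\le\alpha_n$ and $(SI_n)(\alpha_n^* )=(SI_n)(\alpha_n)$.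
   Context: For an integer $n\ge1$ put $a_n=\frac{(2n)!!}{2^n(2n-1)!!}$, $I_n(\theta)=a_n(1+\cos\theta)^n=2^na_n\cos^{2n}\frac{\theta}{2}$ and $S(\theta)=-\sin\theta$; $SI_n$ denotes the product function $\theta\mapsto S(\theta)I_n(\theta)$. Its minimum point on $(0,\pi)$ is $\beta_n=\cos^{-1}\left(\frac{n}{n+1}\right)$. The Winfree model of order $n$ with natural frequencies $\nu_1,\dots,\nu_N\in\mathbb R$ and coupling strength $\kappa$ is the ODE system on $\mathbb R^N$ $$\dot\theta_i=\nu_i+\frac{\kappa}{N}\sum_{j=1}^N I_n(\theta_j)S(\theta_i),\qquad i=1,\dots,N.$$ For $\alpha\in(0,\pi)$, $B(\alpha):=\{\Theta=(\theta_1,\dots,\theta_N)\in\mathbb R^N:\ |\theta_i|<\alpha\text{ for all } i=1,\dots,N\}$. *)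

theory Defs
  imports "HOL-Analysis.Analysis"
begin

fun dfact :: "nat \<Rightarrow> nat" where
  "dfact 0 = 1"
| "dfact (Suc 0) = 1"
| "dfact (Suc (Suc n)) = Suc (Suc n) * dfact n"

definition winfree_a :: "nat \<Rightarrow> real" where
  "winfree_a n = real (dfact (2 * n)) / (2 ^ n * real (dfact (2 * n - 1)))"

definition winfree_I :: "nat \<Rightarrow> real \<Rightarrow> real" where
  "winfree_I n \<theta> = winfree_a n * (1 + cos \<theta>) ^ n"

definition winfree_S :: "real \<Rightarrow> real" where
  "winfree_S \<theta> = - sin \<theta>"

definition winfree_SI :: "nat \<Rightarrow> real \<Rightarrow> real" where
  "winfree_SI n \<theta> = winfree_S \<theta> * winfree_I n \<theta>"

definition winfree_field ::
  "nat \<Rightarrow> real ^ 'N \<Rightarrow> real \<Rightarrow> real ^ 'N \<Rightarrow> real ^ 'N::finite" where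
  "winfree_field n \<nu> \<kappa> \<Theta> =
     (\<chi> i. \<nu> $ i + \<kappa> / real CARD('N) *
        (\<Sum>j\<in>UNIV. winfree_I n (\<Theta> $ j) * winfree_S (\<Theta> $ i)))"

text \<open>Values of \<open>\<Theta>\<close> at negative times are irrelevant; at time 0 the derivative is one-sided.\<close>
definition winfree_solution ::
  "nat \<Rightarrow> real ^ 'N \<Rightarrow> real \<Rightarrow> (real \<Rightarrow> real ^ 'N::finite) \<Rightarrow> bool" where
  "winfree_solution n \<nu> \<kappa> \<Theta> \<longleftrightarrow>
     (\<forall>t\<ge>0. (\<Theta> has_vector_derivative winfree_field n \<nu> \<kappa> (\<Theta> t)) (at t within {0..}))"

definition phase_box :: "real \<Rightarrow> (real ^ 'N::finite) set" where
  "phase_box \<alpha> = {\<Theta>. \<forall>i. \<bar>\<Theta> $ i\<bar> < \<alpha>}"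

lemma dfact_pos: "dfact n > 0"
  by (induction n rule: dfact.induct) auto

lemma winfree_a_pos: "winfree_a n > 0"
  by (simp add: winfree_a_def dfact_pos)

lemma winfree_I_half_angle: "winfree_I n \<theta> = 2 ^ n * winfree_a n * cos (\<theta> / 2) ^ (2 * n)"
proof -
  have "1 + cos \<theta> = 2 * (cos (\<theta> / 2))\<^sup>2"
    using cos_double_cos[of "\<theta> / 2"] by simp
  then show ?thesis
    by (simp add: winfree_I_def power_mult_distrib power_mult)
qed

lemma winfree_SI_has_derivative:
  assumes "n \<ge> 1"
  shows "(winfree_SI n has_real_derivative
           winfree_a n * (1 + cos \<theta>) ^ n * (real n - (real n + 1) * cos \<theta>)) (at \<theta>)"
proof -
  obtain m where n: "n = Suc m"
    using assms by (cases n) auto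
  have s: "sin \<theta> * sin \<theta> = (1 - cos \<theta>) * (1 + cos \<theta>)"
    using sin_cos_squared_add[of \<theta>] by (simp add: power2_eq_square algebra_simps)
  have "(winfree_SI n has_real_derivative
          (- cos \<theta>) * (winfree_a n * (1 + cos \<theta>) ^ n)
          + winfree_a n * (real n * (1 + cos \<theta>) ^ m) * (sin \<theta> * sin \<theta>)) (at \<theta>)"
    unfolding winfree_SI_def[abs_def] winfree_S_def winfree_I_def n
    by (rule derivative_eq_intros refl | simp add: algebra_simps)+
  moreover have "(- cos \<theta>) * (winfree_a n * (1 + cos \<theta>) ^ n)
          + winfree_a n * (real n * (1 + cos \<theta>) ^ m) * (sin \<theta> * sin \<theta>)
        = winfree_a n * (1 + cos \<theta>) ^ n * (real n - (real n + 1) * cos \<theta>)"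
    unfolding s n by (simp add: algebra_simps)
  ultimately show ?thesis
    by simp
qed

lemma winfree_SI_minimum_point:
  assumes "n \<ge> 1"
  shows "is_arg_min (winfree_SI n) (\<lambda>\<theta>. \<theta> \<in> {0<..<pi}) \<beta>
           \<longleftrightarrow> \<beta> = arccos (real n / (real n + 1))"
proof -
  define b where "b = arccos (real n / (real n + 1))"
  have r: "-1 < real n / (real n + 1)" "real n / (real n + 1) < 1"
    by (simp_all add: field_simps)
  have b: "0 < b" "b < pi"
    using arccos_lt_bounded[OF r] by (simp_all add: b_def)
  have cb: "(real n + 1) * cos b = real n"
    using r by (simp add: b_def cos_arccos)
  have pos: "1 + cos x > 0" if "0 < x" "x < pi" for x
    using cos_monotone_0_pi[of x pi] that by simp
  have less: "winfree_SI n b < winfree_SI n x" if x: "0 < x" "x < pi" "x \<noteq> b" for x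
  proof (cases "x < b")
    case True
    show ?thesis
    proof (rule DERIV_neg_imp_decreasing_open[OF True])
      fix y assume y: "x < y" "y < b"
      have "cos b < cos y"
        using cos_monotone_0_pi[of y b] y x b by simp
      then have "(real n + 1) * cos b < (real n + 1) * cos y"
        by (intro mult_strict_left_mono) auto
      then have "winfree_a n * (1 + cos y) ^ n * (real n - (real n + 1) * cos y) < 0"
        using pos[of y] x y b cb winfree_a_pos[of n] by (intro mult_pos_neg mult_pos_pos) auto
      then show "\<exists>d. (winfree_SI n has_real_derivative d) (at y) \<and> d < 0"
        using winfree_SI_has_derivative[OF assms] by blast
    qed (intro continuous_at_imp_continuous_on ballI
          DERIV_isCont[OF winfree_SI_has_derivative[OF assms]])
  next
    case False
    with x have bx: "b < x" by simp
    show ?thesis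
    proof (rule DERIV_pos_imp_increasing_open[OF bx])
      fix y assume y: "b < y" "y < x"
      have "cos y < cos b"
        using cos_monotone_0_pi[of b y] y x b by simp
      then have "(real n + 1) * cos y < (real n + 1) * cos b"
        by (intro mult_strict_left_mono) auto
      then have "winfree_a n * (1 + cos y) ^ n * (real n - (real n + 1) * cos y) > 0"
        using pos[of y] x y b cb winfree_a_pos[of n] by (intro mult_pos_pos) auto
      then show "\<exists>d. (winfree_SI n has_real_derivative d) (at y) \<and> d > 0"
        using winfree_SI_has_derivative[OF assms] by blast
    qed (intro continuous_at_imp_continuous_on ballI
          DERIV_isCont[OF winfree_SI_has_derivative[OF assms]])
  qed
  show ?thesis
    unfolding b_def[symmetric] is_arg_min_def
    using less b by (metis greaterThanLessThan_iff less_asym)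
qed

end

theory Submission imports Defs begin

text \<open>Both signs of every phase are compared with a barrier. When the phase of largest modulus sits at
  the barrier \<open>y\<close>, all \<open>winfree_I n (\<Theta> $ j)\<close> are at least \<open>winfree_I n y\<close>, so its modulus changes at a rate at most
  \<open>\<bar>\<nu> $ i\<bar> + \<kappa> * winfree_SI n y\<close>. This is less than a negative constant for \<open>y\<close> between \<open>\<alpha>\<close> and a
  point slightly below the dual point of \<open>\<alpha>\<close>: a barrier descending linearly from \<open>\<alpha>\<close> is therefore never
  crossed, and neither is the constant barrier at which it ends.\<close>

section \<open>Barriers for finitely many real functions\<close>

text \<open>At the first time some \<open>f k\<close> reaches 0, every other function is still
  nonpositive, so \<open>deriv\<close> applies and makes \<open>f k\<close> strictly decreasing
  there; it would then have been positive shortly before. The derivative is controlled only in this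
  situation, because the field is estimated only when the phase of largest modulus touches the
  barrier.\<close>

lemma first_crossing_barrier:
  fixes f :: "'i \<Rightarrow> real \<Rightarrow> real"
  assumes "finite I"
    and cont: "\<And>i. i \<in> I \<Longrightarrow> continuous_on {a..b} (f i)"
    and init: "\<And>i. i \<in> I \<Longrightarrow> f i a < 0"
    and deriv: "\<And>i t. i \<in> I \<Longrightarrow> t \<in> {a..b} \<Longrightarrow> f i t = 0 \<Longrightarrow> (\<And>j. j \<in> I \<Longrightarrow> f j t \<le> 0)
      \<Longrightarrow> \<exists>D<0. (f i has_real_derivative D) (at t within {a..b})"
    and "i \<in> I" and "t \<in> {a..b}"
  shows "f i t < 0"
proof (rule ccontr)
  assume "\<not> f i t < 0"
  \<comment> \<open>A finite union of closed sets, so the infimum of the bad times is itself a bad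
    time.\<close>
  define A where "A = (\<Union>i\<in>I. {t \<in> {a..b}. 0 \<le> f i t})"
  have tA: "t \<in> A"
    using \<open>i \<in> I\<close> \<open>t \<in> {a..b}\<close> \<open>\<not> f i t < 0\<close> by (auto simp: A_def not_less)
  have "closed A"
    unfolding A_def using \<open>finite I\<close> cont
    by (intro closed_UN ballI continuous_on_closed_Collect_le
        continuous_intros) auto
  define s where "s = Inf A"
  have bdd: "bdd_below A"
    by (rule bdd_belowI[of _ a]) (auto simp: A_def)
  have "s \<in> A"
    unfolding s_def using closed_contains_Inf \<open>closed A\<close> bdd tA by blast
  then obtain k where k: "k \<in> I" "s \<in> {a..b}" "0 \<le> f k s"
    by (auto simp: A_def)
  have before: "f j u < 0" if "j \<in> I" "a \<le> u" "u < s" for j u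
  proof (rule ccontr)
    assume "\<not> f j u < 0"
    then have "u \<in> A"
      using that k by (auto simp: A_def not_less)
    then have "s \<le> u"
      unfolding s_def using bdd by (rule cInf_lower)
    then show False
      using that by simp
  qed
  have "a < s"
    using init[OF k(1)] k by (cases "a = s") auto
  \<comment> \<open>A left limit of negative values; for \<open>k\<close> it forces
    \<open>f k s = 0\<close>.\<close>
  have le: "f j s \<le> 0" if j: "j \<in> I" for j
  proof (rule tendsto_upperbound)
    show "(f j \<longlongrightarrow> f j s) (at s within {a..<s})"
      using cont[OF j] k(2) unfolding continuous_on_def
      by (intro tendsto_within_subset[where S = "{a..b}" and T = "{a..<s}"]) auto
    show "\<forall>\<^sub>F u in at s within {a..<s}. f j u \<le> 0"
      using before[OF j] by (auto simp: eventually_at intro!: exI[of _ 1] less_imp_le)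
    show "at s within {a..<s} \<noteq> bot"
      using \<open>a < s\<close> by (simp add: at_within_eq_bot_iff trivial_limit_within islimpt_Ico)
  qed
  obtain D where D: "D < 0" "(f k has_real_derivative D) (at s within {a..b})"
    using deriv[OF k(1,2)] le k(1,3) by (metis order_antisym)
  from has_real_derivative_neg_dec_left[OF D(2,1)]
  obtain d where d: "d > 0" "\<And>h. 0 < h \<Longrightarrow> s - h \<in> {a..b} \<Longrightarrow> h < d \<Longrightarrow> f k s < f k (s - h)"
    by blast
  \<comment> \<open>Strictly below \<open>d\<close>, yet small enough that \<open>s - h\<close>
    stays in the interval; \<open>s - h = a\<close> is harmless because \<open>before\<close>
    includes \<open>a\<close>.\<close>
  define h where "h = min (d / 2) (s - a)"
  have h: "0 < h" "h < d" "h \<le> s - a"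
    using d(1) \<open>a < s\<close> by (auto simp: h_def)
  have "f k s < f k (s - h)"
    using d(2)[of h] h k(2) by auto
  also have "\<dots> < 0"
    using before[OF k(1), of "s - h"] h by simp
  finally show False
    using k(3) by simp
qed

section \<open>Monotonicity and sign of the coupling functions\<close>

lemma winfree_I_antimono:
  assumes "\<bar>x\<bar> \<le> y" "y \<le> pi"
  shows "winfree_I n y \<le> winfree_I n x"
proof -
  have "cos y \<le> cos x"
    using cos_monotone_0_pi_le[of "\<bar>x\<bar>" y] assms by simp
  then show ?thesis
    using winfree_a_pos[of n] cos_ge_minus_one[of y]
    unfolding winfree_I_def by (intro mult_left_mono power_mono) (auto simp del: cos_ge_minus_one)
qed

lemma winfree_SI_neg:
  assumes "0 < x" "x < pi"
  shows "winfree_SI n x < 0"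
proof -
  have "1 + cos x > 0"
    using cos_monotone_0_pi[of x pi] assms by simp
  then show ?thesis
    using assms sin_gt_zero[of x] winfree_a_pos[of n]
    by (auto simp: winfree_SI_def winfree_S_def winfree_I_def intro!: mult_pos_pos)
qed

lemma continuous_on_winfree_SI: "continuous_on A (winfree_SI n)"
  unfolding winfree_SI_def[abs_def] winfree_S_def winfree_I_def
  by (intro continuous_intros)

text \<open>The third fact says that the factor \<open>real n - (real n + 1) * cos \<theta>\<close>
  of the derivative of \<open>winfree_SI\<close> vanishes at \<open>b\<close>. Its sign on either
  side then follows from the monotonicity of cosine.\<close>

lemma winfree_critical_point:
  fixes n :: nat
  defines "b \<equiv> arccos (real n / (real n + 1))"
  shows "0 < b" "b < pi" "(real n + 1) * cos b = real n"
proof -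
  have r: "-1 < real n / (real n + 1)" "real n / (real n + 1) < 1"
    by (simp_all add: field_simps)
  show "0 < b" "b < pi"
    using arccos_lt_bounded[OF r] by (simp_all add: b_def)
  show "(real n + 1) * cos b = real n"
    using r by (simp add: b_def cos_arccos)
qed

lemma winfree_SI_strict_decreasing:
  assumes n: "n \<ge> 1" and xy: "0 \<le> x" "x < y" "y \<le> arccos (real n / (real n + 1))"
  shows "winfree_SI n y < winfree_SI n x"
proof (rule DERIV_neg_imp_decreasing_open[OF xy(2)])
  fix z assume z: "x < z" "z < y"
  define b where "b = arccos (real n / (real n + 1))"
  note b = winfree_critical_point[of n, folded b_def]
  have "(real n + 1) * cos b = real n"
    by (rule b(3))
  moreover have "cos b < cos z"
    using cos_monotone_0_pi[of z b] z xy b by (simp add: b_def)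
  then have "(real n + 1) * cos b < (real n + 1) * cos z"
    by (intro mult_strict_left_mono) auto
  moreover have "1 + cos z > 0"
    using cos_monotone_0_pi[of z pi] z xy b by (simp add: b_def)
  ultimately have "winfree_a n * (1 + cos z) ^ n * (real n - (real n + 1) * cos z) < 0"
    using winfree_a_pos[of n] by (intro mult_pos_neg mult_pos_pos) auto
  then show "\<exists>d. (winfree_SI n has_real_derivative d) (at z) \<and> d < 0"
    using winfree_SI_has_derivative[OF n] by blast
qed (rule continuous_on_winfree_SI)

lemma winfree_SI_strict_increasing:
  assumes n: "n \<ge> 1" and xy: "arccos (real n / (real n + 1)) \<le> x" "x < y" "y \<le> pi"
  shows "winfree_SI n x < winfree_SI n y"
proof (rule DERIV_pos_imp_increasing_open[OF xy(2)])
  fix z assume z: "x < z" "z < y"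
  define b where "b = arccos (real n / (real n + 1))"
  note b = winfree_critical_point[of n, folded b_def]
  have "(real n + 1) * cos b = real n"
    by (rule b(3))
  moreover have "cos z < cos b"
    using cos_monotone_0_pi[of b z] z xy b by (simp add: b_def)
  then have "(real n + 1) * cos z < (real n + 1) * cos b"
    by (intro mult_strict_left_mono) auto
  moreover have "1 + cos z > 0"
    using cos_monotone_0_pi[of z pi] z xy b by (simp add: b_def)
  ultimately have "winfree_a n * (1 + cos z) ^ n * (real n - (real n + 1) * cos z) > 0"
    using winfree_a_pos[of n] by (intro mult_pos_pos) auto
  then show "\<exists>d. (winfree_SI n has_real_derivative d) (at z) \<and> d > 0"
    using winfree_SI_has_derivative[OF n] by blast
qed (rule continuous_on_winfree_SI)

section \<open>Barriers for the Winfree flow\<close>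

text \<open>The sign \<open>s\<close> treats the upper and the lower face of the box at once: sine
  is odd, so \<open>s * sin (\<Theta> $ i) = sin y\<close> on both. As \<open>sin y\<close> is
  nonnegative, replacing each influence by its lower bound \<open>winfree_I n y\<close> can only
  weaken the pull towards 0.\<close>

lemma winfree_field_bound:
  fixes \<nu> \<Theta> :: "real ^ 'N::finite"
  assumes "\<kappa> \<ge> 0" and s: "s \<in> {1, -1 :: real}"
    and y: "0 \<le> y" "y \<le> pi" "s * \<Theta> $ i = y" "\<And>j. \<bar>\<Theta> $ j\<bar> \<le> y"
  shows "s * winfree_field n \<nu> \<kappa> \<Theta> $ i \<le> \<bar>\<nu> $ i\<bar> + \<kappa> * winfree_SI n y"
proof -
  let ?N = "real CARD('N)"
  have sin: "s * sin (\<Theta> $ i) = sin y"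
    using s y(3) by auto
  have "?N * winfree_I n y = (\<Sum>j\<in>(UNIV :: 'N set). winfree_I n y)"
    by simp
  also have "\<dots> \<le> (\<Sum>j\<in>UNIV. winfree_I n (\<Theta> $ j))"
    using y by (intro sum_mono winfree_I_antimono) auto
  finally have "?N * winfree_I n y * (\<kappa> / ?N * sin y)
      \<le> (\<Sum>j\<in>UNIV. winfree_I n (\<Theta> $ j)) * (\<kappa> / ?N * sin y)"
    using \<open>\<kappa> \<ge> 0\<close> sin_ge_zero[OF y(1,2)] by (intro mult_right_mono) auto
  then have le: "- (\<kappa> / ?N * (\<Sum>j\<in>UNIV. winfree_I n (\<Theta> $ j)) * sin y) \<le> \<kappa> * winfree_SI n y"
    by (simp add: winfree_SI_def winfree_S_def mult_ac)
  have "s * winfree_field n \<nu> \<kappa> \<Theta> $ i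
      = s * \<nu> $ i - \<kappa> / ?N * (\<Sum>j\<in>UNIV. winfree_I n (\<Theta> $ j)) * (s * sin (\<Theta> $ i))"
    by (simp add: winfree_field_def winfree_S_def sum_distrib_left sum_negf algebra_simps)
  also have "\<dots> \<le> \<bar>\<nu> $ i\<bar> + \<kappa> * winfree_SI n y"
    using le s unfolding sin by auto
  finally show ?thesis .
qed

text \<open>By \<open>rate\<close>, a phase touching the barrier of height
  \<open>r - c * (t - a)\<close> moves inwards faster than the barrier does, and the height stays
  within \<open>p\<close> and \<open>q\<close>. The case \<open>c = 0\<close> is allowed, so the
  same statement yields both descent and permanence.\<close>

lemma winfree_linear_barrier:
  fixes \<nu> :: "real ^ 'N::finite" and \<Theta> :: "real \<Rightarrow> real ^ 'N"
  assumes sol: "winfree_solution n \<nu> \<kappa> \<Theta>" and "\<kappa> \<ge> 0"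
    and range: "0 < p" "q < pi"
    and rate: "\<And>i y. p \<le> y \<Longrightarrow> y \<le> q \<Longrightarrow> \<bar>\<nu> $ i\<bar> + \<kappa> * winfree_SI n y < - c"
    and "0 \<le> c" "0 \<le> a" "a \<le> b" "r \<le> q" "p \<le> r - c * (b - a)"
    and init: "\<Theta> a \<in> phase_box r"
  shows "\<Theta> b \<in> phase_box (r - c * (b - a))"
proof -
  \<comment> \<open>The modulus is not differentiable at 0, so each phase contributes two smooth
    functions, one per sign.\<close>
  define f where "f = (\<lambda>(i, s) t. s * \<Theta> t $ i - (r - c * (t - a)))"
  let ?I = "(UNIV :: 'N set) \<times> {1, -1 :: real}"
  have deriv: "(f (i, s) has_real_derivative s * winfree_field n \<nu> \<kappa> (\<Theta> t) $ i + c) (at t within {a..b})"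
    if "t \<in> {a..b}" for i s t
  proof -
    have "(\<Theta> has_vector_derivative winfree_field n \<nu> \<kappa> (\<Theta> t)) (at t within {a..b})"
      using sol that \<open>0 \<le> a\<close> unfolding winfree_solution_def
      by (intro has_vector_derivative_within_subset[where S = "{0..}" and T = "{a..b}"]) auto
    from bounded_linear.has_vector_derivative[OF bounded_linear_vec_nth this]
    have "((\<lambda>t. \<Theta> t $ i) has_real_derivative winfree_field n \<nu> \<kappa> (\<Theta> t) $ i) (at t within {a..b})"
      by (simp add: has_real_derivative_iff_has_vector_derivative)
    then show ?thesis
      unfolding f_def by (auto intro!: derivative_eq_intros)
  qed
  have neg: "f k b < 0" if "k \<in> ?I" for k
  proof (rule first_crossing_barrier[of ?I a b f k b])
    show "continuous_on {a..b} (f k)" for k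
    proof (cases k)
      case (Pair i s)
      show ?thesis
        unfolding Pair using deriv by (rule DERIV_continuous_on)
    qed
    show "f k a < 0" if "k \<in> ?I" for k
      using init that by (auto simp: f_def phase_box_def abs_less_iff)
    show "\<exists>D<0. (f k has_real_derivative D) (at t within {a..b})"
      if k: "k \<in> ?I" and t: "t \<in> {a..b}" and zero: "f k t = 0"
        and le: "\<And>j. j \<in> ?I \<Longrightarrow> f j t \<le> 0" for k t
    proof -
      obtain i s where ks: "k = (i, s)" "s \<in> {1, -1}"
        using k by auto
      define y where "y = r - c * (t - a)"
      have "c * (t - a) \<le> c * (b - a)" "0 \<le> c * (t - a)"
        using t \<open>0 \<le> c\<close> by (auto intro!: mult_left_mono)
      then have y: "p \<le> y" "y \<le> q"
        using assms by (auto simp: y_def)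
      have "\<bar>\<Theta> t $ j\<bar> \<le> y" for j
        using le[of "(j, 1)"] le[of "(j, -1)"] by (auto simp: f_def y_def)
      moreover have "s * \<Theta> t $ i = y"
        using zero by (simp add: f_def ks y_def)
      ultimately have "s * winfree_field n \<nu> \<kappa> (\<Theta> t) $ i \<le> \<bar>\<nu> $ i\<bar> + \<kappa> * winfree_SI n y"
        using \<open>\<kappa> \<ge> 0\<close> ks y range by (intro winfree_field_bound) auto
      also have "\<dots> < - c"
        by (rule rate[OF y])
      finally show ?thesis
        using deriv[OF t, of i s] ks by (intro exI[of _ "s * winfree_field n \<nu> \<kappa> (\<Theta> t) $ i + c"]) auto
    qed
  qed (use that \<open>a \<le> b\<close> in auto)
  show ?thesis
    unfolding phase_box_def
  proof (intro CollectI allI)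
    fix i
    show "\<bar>\<Theta> b $ i\<bar> < r - c * (b - a)"
      using neg[of "(i, 1)"] neg[of "(i, -1)"] by (auto simp: f_def)
  qed
qed

section \<open>Dual point, uniform rate and the two barriers\<close>

theorem theorem4p1:
  fixes n :: nat
    and \<nu> :: "real ^ 'N::finite"
    and \<alpha> \<beta> \<kappa> :: real
    and \<Theta>0 :: "real ^ 'N"
    and \<Theta> :: "real \<Rightarrow> real ^ 'N"
  assumes "n \<ge> 1"
    and "is_arg_min (winfree_SI n) (\<lambda>\<theta>. \<theta> \<in> {0<..<pi}) \<beta>"
    and "\<beta> < \<alpha>" and "\<alpha> < pi"
    and "\<Theta>0 \<in> phase_box \<alpha>"
    and "\<kappa> > (MAX i. \<bar>\<nu> $ i\<bar>) / \<bar>winfree_SI n \<alpha>\<bar>"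
    and "winfree_solution n \<nu> \<kappa> \<Theta>"
    and "\<Theta> 0 = \<Theta>0"
  shows "\<exists>\<alpha>s.
      (0 < \<alpha>s \<and> \<alpha>s < pi \<and> \<alpha>s \<le> \<beta> \<and> \<beta> \<le> \<alpha> \<and> winfree_SI n \<alpha>s = winfree_SI n \<alpha>)
    \<and> (\<forall>a. 0 < a \<and> a < pi \<and> a \<le> \<beta> \<and> \<beta> \<le> \<alpha> \<and> winfree_SI n a = winfree_SI n \<alpha> \<longrightarrow> a = \<alpha>s)
    \<and> (\<exists>t0\<ge>0. \<forall>t\<ge>t0. \<Theta> t \<in> phase_box \<alpha>s)"
proof -
  have \<beta>: "\<beta> = arccos (real n / (real n + 1))"
    using winfree_SI_minimum_point[OF assms(1)] assms(2) by blast
  have \<beta>_range: "0 < \<beta>" "\<beta> < pi"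
    using assms(2) by (auto simp: is_arg_min_def)
  have dec: "winfree_SI n y < winfree_SI n x" if "0 \<le> x" "x < y" "y \<le> \<beta>" for x y
    using winfree_SI_strict_decreasing[OF assms(1)] that \<beta> by blast
  have inc: "winfree_SI n x < winfree_SI n y" if "\<beta> \<le> x" "x < y" "y \<le> pi" for x y
    using winfree_SI_strict_increasing[OF assms(1)] that \<beta> by blast
  have SI\<alpha>: "winfree_SI n \<alpha> < 0"
    using winfree_SI_neg \<beta>_range assms(3,4) by auto
  \<comment> \<open>Bounds for the intermediate value theorem on the interval from 0 to
    \<open>\<beta>\<close>, where \<open>winfree_SI n 0 = 0\<close>.\<close>
  have "winfree_SI n \<beta> \<le> winfree_SI n \<alpha>"
    using inc[of \<beta> \<alpha>] assms(3,4) by simp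
  moreover have "winfree_SI n \<alpha> \<le> winfree_SI n 0"
    using SI\<alpha> by (simp add: winfree_SI_def winfree_S_def)
  ultimately obtain \<alpha>s where \<alpha>s: "0 \<le> \<alpha>s" "\<alpha>s \<le> \<beta>" "winfree_SI n \<alpha>s = winfree_SI n \<alpha>"
    using IVT2'[of "winfree_SI n" \<beta> "winfree_SI n \<alpha>" 0] \<beta>_range continuous_on_winfree_SI
    by auto
  have "\<alpha>s \<noteq> 0"
    using \<alpha>s(3) SI\<alpha> by (auto simp: winfree_SI_def winfree_S_def)
  then have \<alpha>s_pos: "0 < \<alpha>s"
    using \<alpha>s by simp
  define M where "M = (MAX i. \<bar>\<nu> $ i\<bar>)"
  have M: "\<bar>\<nu> $ i\<bar> \<le> M" for i
    unfolding M_def by (intro Max_ge) auto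
  \<comment> \<open>Any index serves to bound the maximum below; \<open>undefined\<close> names
    one.\<close>
  have "0 \<le> M"
    using M[of undefined] abs_ge_zero[of "\<nu> $ undefined"] by linarith
  then have \<kappa>: "0 \<le> \<kappa>"
    using assms(6) unfolding M_def[symmetric]
    by (meson abs_ge_zero divide_nonneg_nonneg less_imp_le order_trans)
  have "M < - \<kappa> * winfree_SI n \<alpha>"
    using assms(6) SI\<alpha> unfolding M_def[symmetric] by (simp add: field_simps)
  \<comment> \<open>The coupling condition passes to the dual point because the values agree. By
    continuity the strict inequality survives at some \<open>p\<close> just left of
    \<open>\<alpha>s\<close>, the height at which the descending barrier will stop.\<close>
  then have "M + \<kappa> * winfree_SI n \<alpha>s < 0"
    using \<alpha>s(3) by simp
  moreover have "isCont (\<lambda>x. M + \<kappa> * winfree_SI n x) \<alpha>s"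
    using continuous_on_winfree_SI[of UNIV n]
    by (intro continuous_intros) (auto simp: continuous_on_eq_continuous_at)
  then have "((\<lambda>x. M + \<kappa> * winfree_SI n x) \<longlongrightarrow> M + \<kappa> * winfree_SI n \<alpha>s) (at_left \<alpha>s)"
    unfolding isCont_def by (rule tendsto_within_subset) simp
  ultimately have "\<forall>\<^sub>F x in at_left \<alpha>s. M + \<kappa> * winfree_SI n x < 0"
    by (intro order_tendstoD(2))
  moreover have "\<forall>\<^sub>F x in at_left \<alpha>s. x \<in> {0<..<\<alpha>s}"
    by (rule eventually_at_leftI[OF _ \<alpha>s_pos]) auto
  ultimately obtain p where p: "M + \<kappa> * winfree_SI n p < 0" "0 < p" "p < \<alpha>s"
    using eventually_happens'[OF trivial_limit_at_left_real eventually_conj] by force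
  \<comment> \<open>The maximum over the whole range is at \<open>p\<close>: the function falls
    until \<open>\<beta>\<close> and then climbs back only to its value at \<open>\<alpha>s\<close>,
    which is below that at \<open>p\<close>.\<close>
  have SI_le: "winfree_SI n y \<le> winfree_SI n p" if y: "p \<le> y" "y \<le> \<alpha>" for y
  proof (cases "y \<le> \<beta>")
    case True
    then show ?thesis
      using dec[of p y] y p by (cases "p = y") auto
  next
    case False
    then have "winfree_SI n y \<le> winfree_SI n \<alpha>s"
      using inc[of y \<alpha>] y \<alpha>s(3) assms(4) by (cases "y = \<alpha>") auto
    also have "\<dots> < winfree_SI n p"
      using dec[of p \<alpha>s] p \<alpha>s by simp
    finally show ?thesis by simp
  qed
  \<comment> \<open>Half of the guaranteed inward speed, which leaves the strict margin that
    \<open>rate\<close> asks for.\<close>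
  define c where "c = - ((M + \<kappa> * winfree_SI n p) / 2)"
  have c: "0 < c"
    using p by (simp add: c_def)
  have rate: "\<bar>\<nu> $ i\<bar> + \<kappa> * winfree_SI n y < - c" if "p \<le> y" "y \<le> \<alpha>" for i y
  proof -
    have "\<bar>\<nu> $ i\<bar> + \<kappa> * winfree_SI n y \<le> M + \<kappa> * winfree_SI n p"
      by (rule add_mono[OF M mult_left_mono[OF SI_le[OF that] \<kappa>]])
    also have "\<dots> < - c"
      using p(1) by (simp add: c_def)
    finally show ?thesis .
  qed
  \<comment> \<open>The time the barrier of slope \<open>- c\<close> takes from
    \<open>\<alpha>\<close> down to \<open>p\<close>; it serves as \<open>t0\<close>.\<close>
  define T where "T = (\<alpha> - p) / c"
  have T: "0 \<le> T" "c * T = \<alpha> - p"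
    using c p \<alpha>s assms(3) by (auto simp: T_def)
  have "\<Theta> T \<in> phase_box (\<alpha> - c * (T - 0))"
    by (rule winfree_linear_barrier[where p = p and q = \<alpha>])
      (use assms \<kappa> p(2) rate c T in auto)
  then have box_T: "\<Theta> T \<in> phase_box p"
    using T by simp
  have "\<Theta> t \<in> phase_box \<alpha>s" if "T \<le> t" for t
  proof -
    \<comment> \<open>From \<open>T\<close> on the barrier is constant at height \<open>p\<close>,
      which is below \<open>\<alpha>s\<close>.\<close>
    have "\<Theta> t \<in> phase_box (p - 0 * (t - T))"
    proof (rule winfree_linear_barrier[where p = p and q = \<alpha>])
      show "\<bar>\<nu> $ i\<bar> + \<kappa> * winfree_SI n y < - 0" if "p \<le> y" "y \<le> \<alpha>" for i y
        using rate[OF that, of i] c by linarith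
    qed (use assms \<kappa> p \<alpha>s T box_T that in auto)
    then show ?thesis
      using p(3) by (auto simp: phase_box_def intro: less_trans)
  qed
  moreover have "a = \<alpha>s" if "0 < a" "a \<le> \<beta>" "winfree_SI n a = winfree_SI n \<alpha>" for a
    using dec[of a \<alpha>s] dec[of \<alpha>s a] that \<alpha>s by (cases a \<alpha>s rule: linorder_cases) auto
  moreover have "\<alpha>s < pi" "\<beta> \<le> \<alpha>"
    using \<alpha>s(2) \<beta>_range assms(3) by auto
  ultimately show ?thesis
    using \<alpha>s \<alpha>s_pos T(1) by blast
qed

end
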